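(* Let $a$, $x$ and $m$ be integers with $m\neq0$, and let $c_1,\dots,c_{\varphi(m)}$ be a reduced residue system modulo $m$. Let $s\ge 0$ and $m_s$ be the integers obtained from the pair $(a,m)$ by the algorithm described in the context. Then the following congruences hold modulo $m$: $$c_1\cdots c_{\varphi(m)}\,a^{\varphi(m_s)+s}-L(0,m)\,a^s\equiv0,\qquad -L(0,m)\,a^{\varphi(m_s)+s}+c_1\cdots c_{\varphi(m)}\,a^s\equiv0,$$ and, more generally, $$(x+c_1)\cdots(x+c_{\varphi(m)})\,a^{\varphi(m_s)+s}-L(x,m)\,a^s\equiv0,$$ $$-L(x,m)\,a^{\varphi(m_s)+s}+(x+c_1)\cdots(x+c_{\varphi(m)})\,a^s\equiv0.$$
   Context: For a nonzero integer $m$, $\varphi(m)=\varphi(|m|)$ is Euler's function, and a reduced residue system modulo $m$ is a family of $\varphi(m)$ integers containing exactly one representative of each residue class modulo $m$ relatively prime to $m$. The function $L$ is $L(x,m)=(x+c_1')\cdots(x+c_{\varphi(m)}')$, where $c_1',\dots,c_{\varphi(m)}'$ is a reduced residue system modulo $m$ (modulo $m$ the value does not depend on the choice of system). Algorithm for $(a,m)$: put $d_0=\gcd(a,m)>0$ and write $a=a_0d_0$, $m=m_0d_0$, so that $\gcd(a_0,m_0)=1$. If $d_0=1$, stop with $s=0$ and $m_s=m_0=m$. Otherwise, for $i=1,2,\dots$ put $d_i=\gcd(d_{i-1},m_{i-1})>0$ and write $d_{i-1}=d_{i-1}^{1}d_i$, $m_{i-1}=m_id_i$, so that $\gcd(d_{i-1}^{1},m_i)=1$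 (here $d_{i-1}^1$ is a name, not a power). Stop at the first index $i$ with $d_i=1$; this index is $s$, and $m_s$ is the corresponding $m_i$. The convention $0^0=1$ is used. *)

theory Defs
  imports "HOL-Number_Theory.Number_Theory"
begin

definition phi :: "int \<Rightarrow> nat" where
  "phi m = totient (nat \<bar>m\<bar>)"

text \<open>
  A family is a function on the index set \<open>{1..phi m}\<close>; its values elsewhere are irrelevant.
  That every member is coprime to the modulus follows by counting, see
  \<open>reduced_residue_system_coprime\<close> below.
\<close>

definition reduced_residue_system :: "int \<Rightarrow> (nat \<Rightarrow> int) \<Rightarrow> bool" where
  "reduced_residue_system m c \<longleftrightarrow>
     (\<forall>r. coprime r m \<longrightarrow> (\<exists>!i. i \<in> {1..phi m} \<and> [c i = r] (mod m)))"

text \<open>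
  The system \<open>c'\<close> used to form \<open>L(x, m)\<close> is an explicit argument, since the integer
  \<open>L(x, m)\<close> (unlike its residue class) depends on it.
\<close>

definition L :: "(nat \<Rightarrow> int) \<Rightarrow> int \<Rightarrow> int \<Rightarrow> int" where
  "L c' x m = (\<Prod>i = 1..phi m. x + c' i)"

text \<open>The pair \<open>(d\<^sub>i, m\<^sub>i)\<close>; all divisions are exact.\<close>

primrec alg :: "int \<Rightarrow> int \<Rightarrow> nat \<Rightarrow> int \<times> int" where
  "alg a m 0 = (gcd a m, m div gcd a m)"
| "alg a m (Suc i) =
     (let d = gcd (fst (alg a m i)) (snd (alg a m i)) in (d, snd (alg a m i) div d))"

definition alg_d :: "int \<Rightarrow> int \<Rightarrow> nat \<Rightarrow> int" where
  "alg_d a m i = fst (alg a m i)"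

definition alg_m :: "int \<Rightarrow> int \<Rightarrow> nat \<Rightarrow> int" where
  "alg_m a m i = snd (alg a m i)"

text \<open>The least index exists for nonzero \<open>m\<close>: see \<open>alg_terminates\<close> below.\<close>

definition alg_s :: "int \<Rightarrow> int \<Rightarrow> nat" where
  "alg_s a m = (LEAST i. alg_d a m i = 1)"

lemma alg_d_0: "alg_d a m 0 = gcd a m"
  by (simp add: alg_d_def)

lemma alg_d_Suc: "alg_d a m (Suc i) = gcd (alg_d a m i) (alg_m a m i)"
  by (simp add: alg_d_def alg_m_def Let_def)

lemma alg_m_0: "m = alg_m a m 0 * alg_d a m 0"
  by (simp add: alg_d_def alg_m_def)

lemma alg_m_Suc: "alg_m a m i = alg_m a m (Suc i) * alg_d a m (Suc i)"
  by (simp add: alg_d_def alg_m_def Let_def)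

lemma alg_m_nonzero: "m \<noteq> 0 \<Longrightarrow> alg_m a m i \<noteq> 0"
proof (induction i)
  case 0
  then show ?case using alg_m_0[of m a] by auto
next
  case (Suc i)
  then show ?case using alg_m_Suc[of a m i] by auto
qed

lemma alg_d_pos: "m \<noteq> 0 \<Longrightarrow> alg_d a m i > 0"
  using alg_m_nonzero[of m a] by (cases i) (auto simp: alg_d_0 alg_d_Suc)

lemma alg_terminates:
  assumes "m \<noteq> 0"
  shows "\<exists>i. alg_d a m i = 1"
proof (rule ccontr)
  assume "\<not> ?thesis"
  then have big: "alg_d a m i \<ge> 2" for i
    using alg_d_pos[OF assms, of a i] by (metis int_one_le_iff_zero_less one_add_one order_le_less zless_imp_add1_zle)
  have dec: "\<bar>alg_m a m (Suc i)\<bar> < \<bar>alg_m a m i\<bar>" for i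
  proof -
    have "\<bar>alg_m a m i\<bar> = \<bar>alg_m a m (Suc i)\<bar> * alg_d a m (Suc i)"
      using alg_m_Suc[of a m i] big[of "Suc i"] by (simp add: abs_mult)
    moreover have "\<bar>alg_m a m (Suc i)\<bar> * alg_d a m (Suc i) \<ge> \<bar>alg_m a m (Suc i)\<bar> * 2"
      using big by (intro mult_left_mono) auto
    moreover have "\<bar>alg_m a m (Suc i)\<bar> > 0"
      using alg_m_nonzero[OF assms] by simp
    ultimately show ?thesis by linarith
  qed
  have "\<bar>alg_m a m i\<bar> + int i \<le> \<bar>alg_m a m 0\<bar>" for i
  proof (induction i)
    case (Suc i)
    then show ?case using dec[of i] by simp
  qed simp
  from this[of "Suc (nat \<bar>alg_m a m 0\<bar>)"] show False by simp
qed

lemma alg_s_stop: "m \<noteq> 0 \<Longrightarrow> alg_d a m (alg_s a m) = 1"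
  unfolding alg_s_def by (rule LeastI_ex) (rule alg_terminates)

lemma reduced_residue_system_coprime:
  assumes "m \<noteq> 0" and c: "reduced_residue_system m c" and j: "j \<in> {1..phi m}"
  shows "coprime (c j) m"
proof -
  define T where "T = totatives (nat \<bar>m\<bar>)"
  have "\<forall>r\<in>T. \<exists>i. i \<in> {1..phi m} \<and> [c i = int r] (mod m)"
  proof
    fix r assume "r \<in> T"
    then have "coprime (int r) m"
      by (auto simp: T_def totatives_def simp flip: coprime_int_iff)
    then show "\<exists>i. i \<in> {1..phi m} \<and> [c i = int r] (mod m)"
      using c unfolding reduced_residue_system_def by blast
  qed
  then obtain f where f: "\<And>r. r \<in> T \<Longrightarrow> f r \<in> {1..phi m} \<and> [c (f r) = int r] (mod m)"
    by metis
  have "inj_on f T"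
  proof (rule inj_onI)
    fix r r' assume r: "r \<in> T" "r' \<in> T" "f r = f r'"
    then have "[int r = int r'] (mod m)"
      using f by (metis cong_sym cong_trans)
    then have "[r = r'] (mod nat \<bar>m\<bar>)"
      by (simp add: cong_iff_dvd_diff flip: cong_int_iff)
    moreover have "0 < r" "r \<le> nat \<bar>m\<bar>" "0 < r'" "r' \<le> nat \<bar>m\<bar>"
      using r by (auto simp: T_def totatives_def)
    ultimately show "r = r'"
      unfolding cong_def by (cases "r = nat \<bar>m\<bar>"; cases "r' = nat \<bar>m\<bar>") simp_all
  qed
  then have "card (f ` T) = card {1..phi m}"
    by (simp add: card_image T_def phi_def totient_def)
  then have "f ` T = {1..phi m}"
    using f by (intro card_subset_eq) auto
  then obtain r where "r \<in> T" "j = f r"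
    using j by blast
  then have "[int r = c j] (mod m)" "coprime (int r) m"
    using f by (auto simp: T_def totatives_def cong_sym simp flip: coprime_int_iff)
  then show ?thesis
    by (rule cong_imp_coprime)
qed

end

theory Submission
  imports Defs
begin

text \<open>
  Two reduced residue systems agree modulo \<open>m\<close> up to a permutation of the indices, so the
  product over \<open>x + c i\<close> and \<open>L c' x m\<close> are congruent modulo \<open>m\<close> (lemma \<open>L_cong\<close>). All four
  congruences therefore reduce to \<open>a\<^bsup>\<phi>(m\<^sub>s) + s\<^esup> \<equiv> a\<^sup>s\<close> modulo \<open>m\<close>, a form of Euler's theorem
  that does not ask for \<open>a\<close> to be coprime to the modulus.

  The algorithm is designed for this: it splits \<open>m\<close> into \<open>m\<^sub>s\<close> and the product of
  \<open>d\<^sub>0, \<dots>, d\<^sub>s\<close>. Every \<open>d\<^sub>i\<close> divides \<open>a\<close> and \<open>d\<^sub>s = 1\<close>, so that product divides \<open>a\<^sup>s\<close>. On the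
  other hand, a common divisor of \<open>a\<close> and \<open>m\<^sub>s\<close> survives in every \<open>d\<^sub>i\<close>, hence divides
  \<open>d\<^sub>s = 1\<close>; thus \<open>a\<close> is coprime to \<open>m\<^sub>s\<close>, and \<open>m\<^sub>s\<close> divides \<open>a\<^bsup>\<phi>(m\<^sub>s)\<^esup> - 1\<close> by Euler's theorem.
  Multiplying the two divisibilities gives the claim.
\<close>

text \<open>
  Sending \<open>i\<close> to the index at which \<open>c\<close> represents the class of \<open>c' i\<close> is injective, because
  \<open>c'\<close> takes each class only once; on a finite index set it is a permutation.
\<close>

lemma L_cong:
  assumes "m \<noteq> 0" and c: "reduced_residue_system m c" and c': "reduced_residue_system m c'"
  shows "[L c x m = L c' x m] (mod m)"
proof -
  let ?I = "{1..phi m}"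
  have cop: "coprime (c' i) m" if "i \<in> ?I" for i
    using reduced_residue_system_coprime[OF \<open>m \<noteq> 0\<close> c' that] .
  then have "\<forall>i\<in>?I. \<exists>j. j \<in> ?I \<and> [c j = c' i] (mod m)"
    using c unfolding reduced_residue_system_def by blast
  then obtain h where h: "\<And>i. i \<in> ?I \<Longrightarrow> h i \<in> ?I \<and> [c (h i) = c' i] (mod m)"
    by metis
  have "inj_on h ?I"
  proof (rule inj_onI)
    fix i j assume ij: "i \<in> ?I" "j \<in> ?I" "h i = h j"
    then have "[c' i = c' j] (mod m)"
      using h by (metis cong_sym cong_trans)
    moreover have "\<exists>!k. k \<in> ?I \<and> [c' k = c' j] (mod m)"
      using c' cop[OF ij(2)] unfolding reduced_residue_system_def by blast
    ultimately show "i = j"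
      using ij by (metis cong_refl)
  qed
  moreover have "h ` ?I \<subseteq> ?I"
    using h by blast
  ultimately have "bij_betw h ?I ?I"
    by (simp add: bij_betw_def endo_inj_surj)
  then have "(\<Prod>i\<in>?I. x + c i) = (\<Prod>i\<in>?I. x + c (h i))"
    by (rule prod.reindex_bij_betw[symmetric])
  also have "[\<dots> = (\<Prod>i\<in>?I. x + c' i)] (mod m)"
    using h by (intro cong_prod cong_add cong_refl) blast
  finally show ?thesis
    by (simp add: L_def)
qed

lemma euler_theorem_int:
  fixes a m :: int
  assumes "coprime a m"
  shows "[a ^ phi m = 1] (mod m)"
proof (cases "m = 0")
  case True
  then show ?thesis by (simp add: phi_def)
next
  case False
  define b where "b = nat (a mod \<bar>m\<bar>)"
  have b: "int b = a mod \<bar>m\<bar>"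
    using False by (simp add: b_def)
  then have ba: "[int b = a] (mod \<bar>m\<bar>)"
    by (simp add: cong_def)
  then have "coprime (int b) (int (nat \<bar>m\<bar>))"
    using assms cong_imp_coprime[OF cong_sym[OF ba]] by simp
  then have "[b ^ totient (nat \<bar>m\<bar>) = 1] (mod nat \<bar>m\<bar>)"
    by (intro euler_theorem) (simp only: coprime_int_iff)
  then have "[int b ^ phi m = 1] (mod \<bar>m\<bar>)"
    by (simp add: phi_def flip: cong_int_iff)
  moreover have "[int b ^ phi m = a ^ phi m] (mod \<bar>m\<bar>)"
    using ba by (rule cong_pow)
  ultimately have "[a ^ phi m = 1] (mod \<bar>m\<bar>)"
    using cong_sym cong_trans by blast
  then show ?thesis
    by (simp add: cong_iff_dvd_diff)
qed

lemma alg_d_dvd: "alg_d a m i dvd a"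
proof (induction i)
  case (Suc i)
  then show ?case
    unfolding alg_d_Suc by (rule dvd_trans[OF gcd_dvd1])
qed (simp add: alg_d_0)

lemma alg_m_mult_prod_alg_d: "alg_m a m n * (\<Prod>i\<le>n. alg_d a m i) = m"
proof (induction n)
  case 0
  show ?case using alg_m_0[of m a] by simp
next
  case (Suc n)
  then show ?case using alg_m_Suc[of a m n] by (simp add: mult_ac)
qed

text \<open>
  A divisor of \<open>m\<^sub>n\<close> divides every earlier \<open>m\<^sub>i\<close>, so the successive gcds never remove it
  from \<open>d\<^sub>i\<close>.
\<close>

lemma common_dvd_alg_d:
  assumes "g dvd a" and "g dvd alg_m a m n"
  shows "g dvd alg_d a m n"
  using assms(2)
proof (induction n)
  case 0
  then have "g dvd m"
    using alg_m_0[of m a] by (metis dvd_mult2)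
  then show ?case
    using \<open>g dvd a\<close> by (simp add: alg_d_0)
next
  case (Suc n)
  then have "g dvd alg_m a m n"
    using alg_m_Suc[of a m n] by (metis dvd_mult2)
  then show ?case
    using Suc.IH by (simp add: alg_d_Suc)
qed

lemma coprime_alg_m_alg_s:
  assumes "m \<noteq> 0"
  shows "coprime a (alg_m a m (alg_s a m))"
  by (rule coprimeI) (metis common_dvd_alg_d alg_s_stop[OF assms])

lemma prod_alg_d_dvd_power:
  assumes "m \<noteq> 0"
  shows "(\<Prod>i\<le>alg_s a m. alg_d a m i) dvd a ^ alg_s a m"
proof -
  \<comment> \<open>There are \<open>s + 1\<close> factors, but the last one is \<open>1\<close>; hence the exponent \<open>s\<close> suffices.\<close>
  have "(\<Prod>i\<le>alg_s a m. alg_d a m i) = (\<Prod>i<alg_s a m. alg_d a m i)"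
    by (simp add: alg_s_stop[OF assms] flip: lessThan_Suc_atMost)
  also have "\<dots> dvd (\<Prod>i<alg_s a m. a)"
    by (intro prod_dvd_prod alg_d_dvd)
  finally show ?thesis
    by simp
qed

theorem euler_theorem_alg:
  assumes "m \<noteq> 0"
  shows "[a ^ (phi (alg_m a m (alg_s a m)) + alg_s a m) = a ^ alg_s a m] (mod m)"
proof -
  let ?s = "alg_s a m"
  let ?n = "alg_m a m ?s"
  have "?n dvd a ^ phi ?n - 1"
    using euler_theorem_int[OF coprime_alg_m_alg_s[OF assms]] by (simp add: cong_iff_dvd_diff)
  then have "?n * (\<Prod>i\<le>?s. alg_d a m i) dvd (a ^ phi ?n - 1) * a ^ ?s"
    by (intro mult_dvd_mono prod_alg_d_dvd_power assms)
  then show ?thesis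
    by (simp add: alg_m_mult_prod_alg_d cong_iff_dvd_diff power_add left_diff_distrib)
qed

theorem mainTheorem2:
  fixes a x m :: int and c c' :: "nat \<Rightarrow> int" and s :: nat and m\<^sub>s :: int
  assumes "m \<noteq> 0"
    and "reduced_residue_system m c"
    and "reduced_residue_system m c'"
    and "s = alg_s a m"
    and "m\<^sub>s = alg_m a m s"
  shows "[(\<Prod>i = 1..phi m. c i) * a ^ (phi m\<^sub>s + s) - L c' 0 m * a ^ s = 0] (mod m) \<and>
    [- L c' 0 m * a ^ (phi m\<^sub>s + s) + (\<Prod>i = 1..phi m. c i) * a ^ s = 0] (mod m) \<and>
    [(\<Prod>i = 1..phi m. x + c i) * a ^ (phi m\<^sub>s + s) - L c' x m * a ^ s = 0] (mod m) \<and>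
    [- L c' x m * a ^ (phi m\<^sub>s + s) + (\<Prod>i = 1..phi m. x + c i) * a ^ s = 0] (mod m)"
proof -
  have pow: "[a ^ (phi m\<^sub>s + s) = a ^ s] (mod m)"
    using euler_theorem_alg[OF \<open>m \<noteq> 0\<close>] assms(4,5) by simp
  have "[L c y m * a ^ (phi m\<^sub>s + s) - L c' y m * a ^ s = 0] (mod m)" (is ?A)
    and "[- L c' y m * a ^ (phi m\<^sub>s + s) + L c y m * a ^ s = 0] (mod m)" (is ?B) for y
  proof -
    have eq: "[L c y m = L c' y m] (mod m)"
      using assms(1-3) by (rule L_cong)
    show ?A
      using cong_mult[OF eq pow] by (simp add: cong_diff_iff_cong_0)
    have "[L c y m * a ^ s - L c' y m * a ^ (phi m\<^sub>s + s) = 0] (mod m)"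
      using cong_mult[OF eq cong_sym[OF pow]] by (simp add: cong_diff_iff_cong_0)
    then show ?B
      by simp
  qed
  from this[of 0] this[of x] show ?thesis
    by (simp add: L_def)
qed

end
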